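(* For any $Y\in\mathbb{R}^{n\times r}$, with $i$th row denoted $y_i^\top$, one has $\mathcal{F}(Y)\ne\emptyset$ if and only if the geometric median problem $$\min\left\{f(b):=\sum_{i=1}^n\|y_i-b\|_2:\ b\in\mathbb{R}^r\right\}$$ has an optimal solution $b_0\notin\{y_i:\ i\in[n]\}$.
   Context: $\mathcal{B}_{n,r}:=\{R\in\mathbb{R}^{n\times r}:\ \mathrm{diag}(RR^\top)=e,\ R^\top e=0\}$, where $e\in\mathbb{R}^n$ is the all-ones vector and $\mathrm{diag}(X)$ is the diagonal vector of $X$; $[n]=\{1,\dots,n\}$. $[Y]:=\{Y+eb^\top:\ b\in\mathbb{R}^r\}$. For a matrix $Y\in\mathbb{R}^{n\times r}$ with every row nonzero, $\mathcal{O}(Y)$ is the matrix obtained by normalizing each row of $Y$ to unit $2$-norm. $\mathcal{F}(Y):=\{\mathcal{O}(Y_1):\ Y_1\in[Y]\text{ with every row of }Y_1\text{ nonzero}\}\cap\mathcal{B}_{n,r}$. *)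

theory Defs
  imports "HOL-Analysis.Analysis"
begin

text \<open>An \<open>n \<times> r\<close> real matrix has type \<open>real^'r^'n\<close>, so that \<open>CARD('n) = n\<close>, \<open>CARD('r) = r\<close>
  and \<open>row i Y\<close> is the \<open>i\<close>th row of \<open>Y\<close>, viewed as a vector in \<open>\<real>\<^sup>r\<close>.\<close>

definition ones :: "real^'n" where
  "ones = (\<chi> i. 1)"

definition diag_vec :: "real^'n^'n \<Rightarrow> real^'n" where
  "diag_vec X = (\<chi> i. X $ i $ i)"

definition outer_prod :: "real^'n \<Rightarrow> real^'r \<Rightarrow> real^'r^'n" where
  "outer_prod u v = (\<chi> i j. u $ i * v $ j)"

definition B_set :: "(real^'r^'n) set" where
  "B_set = {R. diag_vec (R ** transpose R) = ones \<and> transpose R *v ones = 0}"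

definition translation_class :: "real^'r^'n \<Rightarrow> (real^'r^'n) set" where
  "translation_class Y = {Y + outer_prod ones b | b. True}"

definition rows_nonzero :: "real^'r^'n \<Rightarrow> bool" where
  "rows_nonzero Y \<longleftrightarrow> (\<forall>i. row i Y \<noteq> 0)"

text \<open>Meaningful only for matrices satisfying \<open>rows_nonzero\<close>; a zero row is mapped to zero.\<close>

definition normalize_rows :: "real^'r^'n \<Rightarrow> real^'r^'n" where
  "normalize_rows Y = (\<chi> i. row i Y /\<^sub>R norm (row i Y))"

definition F_set :: "real^'r^'n \<Rightarrow> (real^'r^'n) set" where
  "F_set Y = {normalize_rows Y1 | Y1. Y1 \<in> translation_class Y \<and> rows_nonzero Y1} \<inter> B_set"

definition median_objective :: "real^'r^'n \<Rightarrow> real^'r \<Rightarrow> real" where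
  "median_objective Y b = (\<Sum>i\<in>UNIV. norm (row i Y - b))"

end

theory Submission
  imports Defs
begin

text \<open>Away from the rows \<open>y\<^sub>i\<close> of \<open>Y\<close> the objective \<open>f(b) = \<Sum>\<^sub>i \<parallel>y\<^sub>i - b\<parallel>\<close> is differentiable, with
  gradient \<open>-\<Sum>\<^sub>i (y\<^sub>i - b) / \<parallel>y\<^sub>i - b\<parallel>\<close>. It is also convex, so such a point \<open>b\<close> is a minimizer
  exactly when these unit vectors sum to zero (\<open>median_iff_sum_sgn_eq_0\<close>). But they are the rows of
  the normalization of the translate \<open>Y - e b\<^sup>T\<close>, whose diagonal condition is automatic, so their sum
  being zero says precisely that this normalization lies in \<open>\<B>\<close> (\<open>F_set_nonempty_iff\<close>). The
  normalized vector \<open>y / \<parallel>y\<parallel>\<close> is written \<open>sgn y\<close> throughout.\<close>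

lemma B_set_iff: "R \<in> B_set \<longleftrightarrow> (\<forall>i. norm (row i R) = 1) \<and> (\<Sum>i\<in>UNIV. row i R) = 0"
proof -
  have "diag_vec (R ** transpose R) = ones \<longleftrightarrow> (\<forall>i. norm (row i R) = 1)"
    by (simp add: diag_vec_def ones_def vec_eq_iff matrix_matrix_mult_def transpose_def
        norm_eq_1 inner_vec_def row_def)
  moreover have "transpose R *v ones = (\<Sum>i\<in>UNIV. row i R)"
    by (simp add: vec_eq_iff matrix_vector_mult_def transpose_def ones_def row_def)
  ultimately show ?thesis
    by (simp add: B_set_def)
qed

lemma row_normalize_rows: "row i (normalize_rows Y) = sgn (row i Y)"
  by (simp add: normalize_rows_def row_def sgn_div_norm vec_eq_iff)

lemma row_translate: "row i (Y + outer_prod ones b) = row i Y + b"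
  by (simp add: outer_prod_def ones_def row_def vec_eq_iff)

text \<open>Normalized rows have norm 1 automatically, so only the condition \<open>R\<^sup>T e = 0\<close> survives.
  Translates are taken by \<open>-b\<close> here, by \<open>+b\<close> in the translation class; hence the sign changes.\<close>

lemma F_set_nonempty_iff:
  "F_set Y \<noteq> {} \<longleftrightarrow>
    (\<exists>b. (\<forall>i. row i Y \<noteq> b) \<and> (\<Sum>i\<in>UNIV. sgn (row i Y - b)) = 0)"
proof
  assume "F_set Y \<noteq> {}"
  then obtain b where nz: "rows_nonzero (Y + outer_prod ones b)"
    and B: "normalize_rows (Y + outer_prod ones b) \<in> B_set"
    unfolding F_set_def translation_class_def by blast
  have "\<forall>i. row i Y \<noteq> - b"
    using nz by (simp add: rows_nonzero_def row_translate eq_neg_iff_add_eq_0)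
  moreover have "(\<Sum>i\<in>UNIV. sgn (row i Y - - b)) = 0"
    using B by (simp add: B_set_iff row_normalize_rows row_translate)
  ultimately show "\<exists>b. (\<forall>i. row i Y \<noteq> b) \<and> (\<Sum>i\<in>UNIV. sgn (row i Y - b)) = 0"
    by blast
next
  assume "\<exists>b. (\<forall>i. row i Y \<noteq> b) \<and> (\<Sum>i\<in>UNIV. sgn (row i Y - b)) = 0"
  then obtain b where b: "\<And>i. row i Y \<noteq> b" "(\<Sum>i\<in>UNIV. sgn (row i Y - b)) = 0"
    by blast
  let ?Y1 = "Y + outer_prod ones (- b)"
  have "rows_nonzero ?Y1"
    using b(1) by (simp add: rows_nonzero_def row_translate)
  moreover have "normalize_rows ?Y1 \<in> B_set"
    using b by (simp add: B_set_iff row_normalize_rows row_translate norm_sgn)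
  ultimately show "F_set Y \<noteq> {}"
    unfolding F_set_def translation_class_def by blast
qed

text \<open>The vector \<open>sgn x\<close>, of norm at most 1, is a subgradient of the norm: since
  \<open>sgn x \<bullet> x = \<parallel>x\<parallel>\<close>, this is the Cauchy--Schwarz inequality for \<open>sgn x\<close> and \<open>y\<close>.\<close>

lemma norm_ge_tangent:
  fixes x y :: "'a::real_inner"
  shows "norm x + sgn x \<bullet> (y - x) \<le> norm y"
proof -
  have "sgn x \<bullet> x = norm x"
    by (cases "x = 0") (simp_all add: sgn_div_norm dot_square_norm power2_eq_square)
  moreover have "sgn x \<bullet> y \<le> norm y"
    using norm_cauchy_schwarz[of "sgn x" y] by (simp add: norm_sgn split: if_splits)
  ultimately show ?thesis
    by (simp add: inner_diff_right)
qed

lemma median_objective_ge_tangent: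
  "median_objective Y b - (\<Sum>i\<in>UNIV. sgn (row i Y - b)) \<bullet> (c - b) \<le> median_objective Y c"
proof -
  have "norm (row i Y - b) - sgn (row i Y - b) \<bullet> (c - b) \<le> norm (row i Y - c)" for i
    using norm_ge_tangent[of "row i Y - b" "row i Y - c"] by (simp add: inner_diff_right)
  then have "(\<Sum>i\<in>UNIV. norm (row i Y - b) - sgn (row i Y - b) \<bullet> (c - b))
      \<le> (\<Sum>i\<in>UNIV. norm (row i Y - c))"
    by (intro sum_mono)
  then show ?thesis
    by (simp add: median_objective_def inner_sum_left sum_subtractf)
qed

lemma median_objective_has_derivative:
  assumes "\<And>i. row i Y \<noteq> b"
  shows "(median_objective Y has_derivative (\<lambda>h. - ((\<Sum>i\<in>UNIV. sgn (row i Y - b)) \<bullet> h))) (at b)"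
proof -
  have "((\<lambda>c. norm (row i Y - c)) has_derivative (\<lambda>h. - (sgn (row i Y - b) \<bullet> h))) (at b)" for i
  proof -
    have "((\<lambda>c. row i Y - c) has_derivative (\<lambda>h. 0 - h)) (at b)"
      by (rule has_derivative_diff[OF has_derivative_const has_derivative_ident])
    from has_derivative_compose[OF this has_derivative_norm] assms[of i] show ?thesis
      by (simp add: inner_commute)
  qed
  then have "((\<lambda>c. \<Sum>i\<in>UNIV. norm (row i Y - c)) has_derivative
      (\<lambda>h. \<Sum>i\<in>UNIV. - (sgn (row i Y - b) \<bullet> h))) (at b)"
    by (intro has_derivative_sum)
  then show ?thesis
    by (simp add: median_objective_def[abs_def] sum_negf inner_sum_left)
qed

text \<open>Necessity is Fermat's rule; sufficiency holds because the supporting affine function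
  at \<open>b\<close> is then constant.\<close>

lemma median_iff_sum_sgn_eq_0:
  assumes "\<And>i. row i Y \<noteq> b"
  shows "is_arg_min (median_objective Y) (\<lambda>b. True) b \<longleftrightarrow> (\<Sum>i\<in>UNIV. sgn (row i Y - b)) = 0"
    (is "_ \<longleftrightarrow> ?g = 0")
proof
  assume "is_arg_min (median_objective Y) (\<lambda>b. True) b"
  then have "\<forall>c\<in>UNIV. median_objective Y b \<le> median_objective Y c"
    by (simp add: is_arg_min_linorder)
  then have "(\<lambda>h. - (?g \<bullet> h)) = (\<lambda>h. 0)"
    using median_objective_has_derivative[OF assms]
    by (intro differential_zero_maxmin[of b UNIV "median_objective Y"]) auto
  from fun_cong[OF this, of ?g] have "?g \<bullet> ?g = 0"
    by simp
  then show "?g = 0"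
    by simp
next
  assume "?g = 0"
  then show "is_arg_min (median_objective Y) (\<lambda>b. True) b"
    using median_objective_ge_tangent[of Y b] by (simp add: is_arg_min_linorder)
qed

theorem proposition3p7:
  fixes Y :: "real^'r^'n"
  shows "F_set Y \<noteq> {} \<longleftrightarrow>
    (\<exists>b0. is_arg_min (median_objective Y) (\<lambda>b. True) b0 \<and> b0 \<notin> {row i Y | i. True})"
proof -
  have "b \<notin> {row i Y | i. True} \<longleftrightarrow> (\<forall>i. row i Y \<noteq> b)" for b
    by auto
  then show ?thesis
    using median_iff_sum_sgn_eq_0[of Y] by (auto simp: F_set_nonempty_iff)
qed

end
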